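(* Let $f,g:\{0,1\}^n\to\{0,1\}$ be balanced Boolean functions. If $f$ is NPN-equivalent to $g$, then either ($OSV^1(f)=OSV^1(g)$ and $OSV^0(f)=OSV^0(g)$) or ($OSV^1(f)=OSV^0(g)$ and $OSV^0(f)=OSV^1(g)$).
   Context: For a word $X=(x_1,\dots,x_n)\in\{0,1\}^n$, $X^i$ denotes $X$ with its $i$-th bit negated. A selective negation $(\neg)$ is a map $\{0,1\}^n\to\{0,1\}^n$ that negates the bits in some fixed set of positions and leaves the others unchanged. A permutation $\pi$ acts on words by reordering their entries. $f$ is NPN-equivalent to $g$ if there are a permutation $\pi$ and a selective negation $(\neg)$ such that either $f(\pi((\neg)X))=g(X)$ for all $X\in\{0,1\}^n$, or $\neg f(\pi((\neg)X))=g(X)$ for all $X\in\{0,1\}^n$ (i.e. input negation, input permutation and possibly output negation). A function $f$ on $n$ variables is balanced if $|f^{-1}(1)|=|f^{-1}(0)|=2^{n-1}$. The local sensitivity of $f$ at $X$ is $sen(f,X)=|\{i\in\{1,\dots,n\}: f(X)\neq f(X^i)\}|$. For $b\in\{0,1\}$, the ordered $b$-sensitivity vector is $OSV^b(f)=\{sen(f,X): X\in\{0,1\}^n,\ f(X)=b\}_\le$, where $\{\cdot\}_\le$ denotes the multiset (with multiplicities) listed in non-decreasing order. *)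

theory Defs
  imports "HOL-Combinatorics.Permutations"
begin

text \<open>
  Words of length \<open>n\<close> are Boolean lists; positions are numbered \<open>0, \<dots>, n - 1\<close>.
  A Boolean function on \<open>n\<close> variables is a function of type \<open>bool list \<Rightarrow> bool\<close>, of which
  only the values on \<open>words n\<close> matter; local sensitivity is meant for words of length \<open>n\<close>.
\<close>

definition words :: "nat \<Rightarrow> bool list set" where
  "words n = {X. length X = n}"

definition negate_bit :: "nat \<Rightarrow> bool list \<Rightarrow> bool list" where
  "negate_bit i X = X[i := \<not> X ! i]"

definition selective_negation :: "nat set \<Rightarrow> bool list \<Rightarrow> bool list" where
  "selective_negation S X = map (\<lambda>i. if i \<in> S then \<not> X ! i else X ! i) [0..<length X]"

definition NPN_equivalent :: "nat \<Rightarrow> (bool list \<Rightarrow> bool) \<Rightarrow> (bool list \<Rightarrow> bool) \<Rightarrow> bool" where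
  "NPN_equivalent n f g \<longleftrightarrow>
    (\<exists>\<pi> S. \<pi> permutes {..<n} \<and> S \<subseteq> {..<n} \<and>
      ((\<forall>X\<in>words n. f (permute_list \<pi> (selective_negation S X)) = g X) \<or>
       (\<forall>X\<in>words n. (\<not> f (permute_list \<pi> (selective_negation S X))) = g X)))"

text \<open>No function is balanced for \<open>n = 0\<close> (there is one word), so the truncated \<open>n - 1\<close> is harmless.\<close>

definition balanced :: "nat \<Rightarrow> (bool list \<Rightarrow> bool) \<Rightarrow> bool" where
  "balanced n f \<longleftrightarrow>
    card {X \<in> words n. f X = True} = card {X \<in> words n. f X = False} \<and>
    card {X \<in> words n. f X = False} = 2 ^ (n - 1)"

definition sen :: "nat \<Rightarrow> (bool list \<Rightarrow> bool) \<Rightarrow> bool list \<Rightarrow> nat" where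
  "sen n f X = card {i \<in> {..<n}. f X \<noteq> f (negate_bit i X)}"

definition OSV :: "nat \<Rightarrow> bool \<Rightarrow> (bool list \<Rightarrow> bool) \<Rightarrow> nat list" where
  "OSV n b f =
    sorted_list_of_multiset (image_mset (sen n f) (mset_set {X \<in> words n. f X = b}))"

end

theory Submission
  imports Defs
begin

text \<open>
  The input transformation is an automorphism of the hypercube: it is a bijection on words that maps
  the neighbour of a word in direction \<open>\<pi> j\<close> to the neighbour of its image in direction \<open>j\<close>. Hence it
  preserves local sensitivity, and it carries the fibres of one function to those of the other, or
  to the opposite fibres if the output is negated.
\<close>

lemma finite_words: "finite (words n)"
proof -
  have "words n = {X. set X \<subseteq> UNIV \<and> length X = n}"
    by (simp add: words_def)
  then show ?thesis
    using finite_lists_length_eq[of "UNIV :: bool set" n] by simp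
qed

lemma negate_bit_in_words: "X \<in> words n \<Longrightarrow> negate_bit i X \<in> words n"
  by (simp add: words_def negate_bit_def)

lemma input_transform_in_words:
  "X \<in> words n \<Longrightarrow> permute_list \<pi> (selective_negation S X) \<in> words n"
  by (simp add: words_def selective_negation_def)

text \<open>Negation precedes permutation, so membership in \<open>S\<close> is tested at the source
  position \<open>\<pi> j\<close>. The disequality of Booleans is exclusive or.\<close>

lemma nth_input_transform:
  assumes "\<pi> permutes {..<n}" "X \<in> words n" "j < n"
  shows "permute_list \<pi> (selective_negation S X) ! j = (X ! \<pi> j \<noteq> (\<pi> j \<in> S))"
proof -
  have "\<pi> j < n"
    using permutes_in_image[OF assms(1)] assms(3) by auto
  then show ?thesis
    using assms by (auto simp: words_def selective_negation_def permute_list_def)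
qed

text \<open>Output position \<open>j\<close> reads input position \<open>\<pi> j\<close>, and by
  injectivity of \<open>\<pi>\<close> no other output position does; flipping a bit commutes with
  the negation by \<open>S\<close>.\<close>

lemma input_transform_negate_bit:
  assumes \<pi>: "\<pi> permutes {..<n}" and X: "X \<in> words n" and j: "j < n"
  shows "permute_list \<pi> (selective_negation S (negate_bit (\<pi> j) X)) =
         negate_bit j (permute_list \<pi> (selective_negation S X))"
proof (rule nth_equalityI)
  show "length (permute_list \<pi> (selective_negation S (negate_bit (\<pi> j) X))) =
        length (negate_bit j (permute_list \<pi> (selective_negation S X)))"
    by (simp add: negate_bit_def selective_negation_def)
next
  fix k
  assume "k < length (permute_list \<pi> (selective_negation S (negate_bit (\<pi> j) X)))"
  then have k: "k < n"
    using X by (simp add: words_def negate_bit_def selective_negation_def)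
  have len: "length (selective_negation S X) = n" "length X = n"
    using X by (simp_all add: words_def selective_negation_def)
  have lt: "\<pi> k < n" "\<pi> j < n"
    using permutes_in_image[OF \<pi>] j k by auto
  have eq: "\<pi> j = \<pi> k \<longleftrightarrow> j = k"
    using permutes_inj[OF \<pi>] by (auto dest: injD)
  show "permute_list \<pi> (selective_negation S (negate_bit (\<pi> j) X)) ! k =
        negate_bit j (permute_list \<pi> (selective_negation S X)) ! k"
    unfolding nth_input_transform[OF \<pi> negate_bit_in_words[OF X] k]
    by (auto simp: negate_bit_def nth_list_update len lt eq j k
          nth_input_transform[OF \<pi> X])
qed

text \<open>Output bit \<open>j\<close> determines input bit \<open>\<pi> j\<close>, and these
  positions exhaust \<open>{..<n}\<close>, so the map is injective. Finiteness of
  \<open>words n\<close> then yields surjectivity.\<close>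

lemma bij_betw_input_transform:
  assumes \<pi>: "\<pi> permutes {..<n}"
  shows "bij_betw (\<lambda>X. permute_list \<pi> (selective_negation S X)) (words n) (words n)"
proof -
  let ?T = "\<lambda>X. permute_list \<pi> (selective_negation S X)"
  have inj: "inj_on ?T (words n)"
  proof (rule inj_onI)
    fix X Y
    assume X: "X \<in> words n" and Y: "Y \<in> words n" and eq: "?T X = ?T Y"
    show "X = Y"
    proof (rule nth_equalityI)
      show "length X = length Y"
        using X Y by (simp add: words_def)
      fix i assume "i < length X"
      then have "i \<in> \<pi> ` {..<n}"
        using X permutes_image[OF \<pi>] by (simp add: words_def)
      then obtain j where j: "j < n" "i = \<pi> j"
        by auto
      show "X ! i = Y ! i"
        using arg_cong[OF eq, of "\<lambda>Z. Z ! j"]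
          nth_input_transform[OF \<pi> X j(1), of S] nth_input_transform[OF \<pi> Y j(1), of S] j(2)
        by auto
    qed
  qed
  have "?T ` words n \<subseteq> words n"
    by (auto intro: input_transform_in_words)
  then show ?thesis
    using inj endo_inj_surj[OF finite_words] by (auto simp: bij_betw_def)
qed

text \<open>The bit \<open>c\<close> encodes the output polarity: \<open>c = False\<close> is output negation.\<close>

lemma sen_input_transform:
  assumes \<pi>: "\<pi> permutes {..<n}"
    and g: "\<And>X. X \<in> words n \<Longrightarrow> g X = (f (permute_list \<pi> (selective_negation S X)) = c)"
    and X: "X \<in> words n"
  shows "sen n f (permute_list \<pi> (selective_negation S X)) = sen n g X"
proof -
  let ?Y = "permute_list \<pi> (selective_negation S X)"
  \<comment> \<open>Comparison with the fixed bit \<open>c\<close> is injective on Booleans, so it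
    cancels from the disequality for either polarity.\<close>
  have flip: "f ?Y \<noteq> f (negate_bit j ?Y) \<longleftrightarrow> g X \<noteq> g (negate_bit (\<pi> j) X)" if "j < n" for j
    unfolding g[OF X] g[OF negate_bit_in_words[OF X]] input_transform_negate_bit[OF \<pi> X that]
    by auto
  \<comment> \<open>\<open>\<pi>\<close> carries the sensitive directions at \<open>?Y\<close> onto
    those at \<open>X\<close>; being injective, it preserves their number.\<close>
  have "{i \<in> {..<n}. g X \<noteq> g (negate_bit i X)} =
        \<pi> ` {j \<in> {..<n}. f ?Y \<noteq> f (negate_bit j ?Y)}" (is "?I = \<pi> ` ?J")
  proof (intro set_eqI iffI)
    fix i assume i: "i \<in> ?I"
    then have "i \<in> \<pi> ` {..<n}"
      using permutes_image[OF \<pi>] by simp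
    then obtain j where "j < n" "i = \<pi> j"
      by auto
    then show "i \<in> \<pi> ` ?J"
      using i flip[of j] by auto
  next
    fix i assume "i \<in> \<pi> ` ?J"
    then obtain j where "j < n" "f ?Y \<noteq> f (negate_bit j ?Y)" "i = \<pi> j"
      by blast
    then show "i \<in> ?I"
      using flip[of j] permutes_in_image[OF \<pi>, of j] by auto
  qed
  then show ?thesis
    using card_image[OF inj_on_subset[OF permutes_inj[OF \<pi>] subset_UNIV]]
    by (simp add: sen_def)
qed

lemma OSV_input_transform:
  assumes \<pi>: "\<pi> permutes {..<n}"
    and g: "\<And>X. X \<in> words n \<Longrightarrow> g X = (f (permute_list \<pi> (selective_negation S X)) = c)"
  shows "OSV n b g = OSV n (b = c) f"
proof -
  let ?T = "\<lambda>X. permute_list \<pi> (selective_negation S X)"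
  let ?A = "{X \<in> words n. g X = b}"
  let ?B = "{Y \<in> words n. f Y = (b = c)}"
  note bij = bij_betw_input_transform[OF \<pi>, of S]
  \<comment> \<open>Equivalence is associative: \<open>(v = c) = b\<close> iff
    \<open>v = (b = c)\<close>. Thus \<open>b = c\<close> is \<open>b\<close> itself for
    \<open>c = True\<close> and its negation for \<open>c = False\<close>.\<close>
  have "?A = {X \<in> words n. f (?T X) = (b = c)}"
    using g by auto
  then have img: "?T ` ?A = ?B"
    using bij_betw_imp_surj_on[OF bij] by auto
  have inj: "inj_on ?T ?A"
    by (rule inj_on_subset[OF bij_betw_imp_inj_on[OF bij]]) auto
  \<comment> \<open>Reindexing along \<open>?T\<close>, which is injective on \<open>?A\<close>,
    keeps multiplicities.\<close>
  have "image_mset (sen n f) (mset_set ?B) = image_mset (\<lambda>X. sen n f (?T X)) (mset_set ?A)"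
    unfolding img[symmetric] image_mset_mset_set[OF inj, symmetric]
    by (simp add: multiset.map_comp o_def)
  also have "\<dots> = image_mset (sen n g) (mset_set ?A)"
    using sen_input_transform[where f = f and g = g and c = c, OF \<pi> g] finite_words
    by (intro image_mset_cong) simp
  finally show ?thesis
    by (simp add: OSV_def)
qed

theorem theorem3:
  fixes n :: nat and f g :: "bool list \<Rightarrow> bool"
  assumes "balanced n f" and "balanced n g"
    and "NPN_equivalent n f g"
  shows "(OSV n True f = OSV n True g \<and> OSV n False f = OSV n False g) \<or>
         (OSV n True f = OSV n False g \<and> OSV n False f = OSV n True g)"
proof -
  \<comment> \<open>The two alternatives of NPN-equivalence become \<open>c = True\<close> and
    \<open>c = False\<close>; the latter swaps the two vectors.\<close>
  obtain \<pi> S c where "\<pi> permutes {..<n}"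
    and "\<forall>X\<in>words n. g X = (f (permute_list \<pi> (selective_negation S X)) = c)"
    using assms(3) unfolding NPN_equivalent_def by metis
  then have "OSV n b g = OSV n (b = c) f" for b
    by (intro OSV_input_transform) auto
  from this[of True] this[of False] show ?thesis
    by (cases c) auto
qed

end
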